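(* Let $n\ge 2$ be an integer and let $T$ be a spanning tree of the $n$-grid $G_{n,n}$. Then the average length of a fundamental cycle with respect to $T$ is at least $\frac{2}{625}\left\lfloor\log_5 n\right\rfloor$.
   Context: The $n$-grid $G_{n,n}$ is the Cartesian product of two $n$-vertex paths. If $T$ is a spanning tree of a graph $G$ and $e$ is an edge of $G$ not contained in $T$, the fundamental cycle associated with $e$ (with respect to $T$) is the cycle formed by $e$ and the unique path of $T$ joining the two end vertices of $e$. Its length is its number of edges. The average length of a fundamental cycle with respect to $T$ is the arithmetic mean of the lengths of the fundamental cycles associated with all edges of $G$ not contained in $T$. *)

theory Defs
  imports Complex_Main
begin

record 'a ugraph =
  uverts :: "'a set"
  uedges :: "'a set set"

definition path_graph :: "nat \<Rightarrow> nat ugraph" where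
  "path_graph n = \<lparr>uverts = {..<n}, uedges = {{i, Suc i} |i. Suc i < n}\<rparr>"

definition cart_prod :: "'a ugraph \<Rightarrow> 'b ugraph \<Rightarrow> ('a \<times> 'b) ugraph" where
  "cart_prod G H =
    \<lparr>uverts = uverts G \<times> uverts H,
     uedges = {{(u, x), (u, y)} |u x y. u \<in> uverts G \<and> {x, y} \<in> uedges H} \<union>
              {{(u, x), (v, x)} |u v x. {u, v} \<in> uedges G \<and> x \<in> uverts H}\<rparr>"

definition grid :: "nat \<Rightarrow> (nat \<times> nat) ugraph" where
  "grid n = cart_prod (path_graph n) (path_graph n)"

text \<open>Paths and cycles are given by their lists of vertices; in a cycle the
  first vertex is not repeated at the end of the list.\<close>

definition is_upath :: "'a ugraph \<Rightarrow> 'a list \<Rightarrow> bool" where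
  "is_upath G p \<longleftrightarrow> p \<noteq> [] \<and> set p \<subseteq> uverts G \<and> distinct p \<and>
     successively (\<lambda>u v. {u, v} \<in> uedges G) p"

definition upath_edges :: "'a list \<Rightarrow> 'a set set" where
  "upath_edges p = {{p ! i, p ! Suc i} |i. Suc i < length p}"

definition is_ucycle :: "'a ugraph \<Rightarrow> 'a list \<Rightarrow> bool" where
  "is_ucycle G p \<longleftrightarrow> is_upath G p \<and> 3 \<le> length p \<and> {last p, hd p} \<in> uedges G"

definition uconnected :: "'a ugraph \<Rightarrow> bool" where
  "uconnected G \<longleftrightarrow> uverts G \<noteq> {} \<and>
     (\<forall>u\<in>uverts G. \<forall>v\<in>uverts G. \<exists>p. is_upath G p \<and> hd p = u \<and> last p = v)"

definition is_utree :: "'a ugraph \<Rightarrow> bool" where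
  "is_utree T \<longleftrightarrow> uconnected T \<and> (\<nexists>p. is_ucycle T p)"

definition is_spanning_tree :: "'a ugraph \<Rightarrow> 'a ugraph \<Rightarrow> bool" where
  "is_spanning_tree T G \<longleftrightarrow>
     is_utree T \<and> uverts T = uverts G \<and> uedges T \<subseteq> uedges G"

text \<open>The path joining the ends of an edge \<open>e\<close> is described by its edge set: an
  unordered edge does not determine in which direction the path is traversed,
  whereas its edge set is the same for both directions. Likewise the fundamental
  cycle is given by its edge set, so that its length is the cardinality.\<close>

definition tree_path_edges :: "'a ugraph \<Rightarrow> 'a set \<Rightarrow> 'a set set" where
  "tree_path_edges T e =
     (THE P. \<exists>p. is_upath T p \<and> {hd p, last p} = e \<and> P = upath_edges p)"

definition fundamental_cycle :: "'a ugraph \<Rightarrow> 'a set \<Rightarrow> 'a set set" where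
  "fundamental_cycle T e = insert e (tree_path_edges T e)"

definition avg_fundamental_cycle_length :: "'a ugraph \<Rightarrow> 'a ugraph \<Rightarrow> real" where
  "avg_fundamental_cycle_length G T =
     (\<Sum>e\<in>uedges G - uedges T. real (card (fundamental_cycle T e)))
       / real (card (uedges G - uedges T))"

end

theory Submission
  imports Defs
begin

text \<open>The boundary of a square of radius \<open>r\<close> is a cycle of the grid, hence the sum modulo 2
  of the fundamental cycles of its non-tree edges. It surrounds its centre, so one of these
  fundamental cycles surrounds the centre as well and has length at least \<open>r\<close>. Tiling the grid
  by boxes of side \<open>5t\<close> and taking in each box the concentric squares of radius
  \<open>t, \<dots>, 2t - 1\<close>, which are edge-disjoint, yields at least \<open>(n div 5t)\<^sup>2 t \<ge> n\<^sup>2 / (100 t)\<close>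
  non-tree edges with fundamental cycle of length at least \<open>t\<close>. Each of the scales
  \<open>t = 5\<^sup>k\<close>, \<open>k < \<lfloor>log\<^sub>5 n\<rfloor>\<close>, counted with weight \<open>4t/5\<close>, thus contributes
  \<open>n\<^sup>2 / 125\<close> to the total length, and the grid has at most \<open>2n\<^sup>2\<close> edges.\<close>

section \<open>Paths in trees\<close>

lemma upath_edges_Nil [simp]: "upath_edges [] = {}"
  and upath_edges_singleton [simp]: "upath_edges [x] = {}"
  by (auto simp: upath_edges_def)

lemma upath_edges_Cons_Cons [simp]:
  "upath_edges (x # y # p) = insert {x, y} (upath_edges (y # p))"
proof -
  have image: "upath_edges q = (\<lambda>i. {q ! i, q ! Suc i}) ` {i. Suc i < length q}" for q :: "'a list"
    by (simp add: upath_edges_def setcompr_eq_image)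
  have "{i. Suc i < length (x # y # p)} = insert 0 (Suc ` {i. Suc i < length (y # p)})"
  proof (rule set_eqI)
    fix i show "i \<in> {i. Suc i < length (x # y # p)} \<longleftrightarrow>
        i \<in> insert 0 (Suc ` {i. Suc i < length (y # p)})"
      by (cases i) auto
  qed
  then show ?thesis
    unfolding image by (simp add: image_image)
qed

lemma Union_upath_edges_subset: "\<Union> (upath_edges p) \<subseteq> set p"
  by (auto simp: upath_edges_def)

lemma finite_upath_edges [simp]: "finite (upath_edges p)"
  by (induction p rule: induct_list012) auto

lemma notin_upath_edges: "x \<notin> set p \<Longrightarrow> {x, y} \<notin> upath_edges p"
  using Union_upath_edges_subset[of p] by auto

lemma card_upath_edges: "distinct p \<Longrightarrow> card (upath_edges p) = length p - 1"
  by (induction p rule: induct_list012) (auto simp: notin_upath_edges card_insert_if)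

lemma upath_edges_subset:
  "successively (\<lambda>u v. {u, v} \<in> E) p \<Longrightarrow> upath_edges p \<subseteq> E"
  by (induction p rule: induct_list012) auto

text \<open>A walk changes sides of \<open>S\<close> exactly at its edges in \<open>F\<close>;
  distinctness makes the edge set count each traversed edge once. The link between \<open>F\<close>
  and \<open>S\<close> is asked only along \<open>p\<close>, so \<open>S\<close> may be chosen to
  suit a single path.\<close>

lemma odd_card_upath_edges_cut:
  assumes "distinct p" "p \<noteq> []"
    and "successively (\<lambda>u v. {u, v} \<in> F \<longleftrightarrow> (u \<in> S) \<noteq> (v \<in> S)) p"
  shows "odd (card (upath_edges p \<inter> F)) \<longleftrightarrow> (hd p \<in> S) \<noteq> (last p \<in> S)"
  using assms
proof (induction p rule: induct_list012)
  case (3 x y p)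
  then have "{x, y} \<notin> upath_edges (y # p)"
    by (intro notin_upath_edges) auto
  then have "card (upath_edges (x # y # p) \<inter> F) =
      (if {x, y} \<in> F then 1 else 0) + card (upath_edges (y # p) \<inter> F)"
    by (simp add: Int_insert_left)
  with 3 show ?case
    by (auto split: if_splits)
qed auto

lemma mem_upath_edges_iff_cut:
  assumes "distinct p" "p \<noteq> []"
    and "successively (\<lambda>u v. {u, v} = e \<longleftrightarrow> (u \<in> S) \<noteq> (v \<in> S)) p"
  shows "e \<in> upath_edges p \<longleftrightarrow> (hd p \<in> S) \<noteq> (last p \<in> S)"
proof -
  have "odd (card (upath_edges p \<inter> {e})) \<longleftrightarrow> e \<in> upath_edges p"
    by (cases "e \<in> upath_edges p") auto
  then show ?thesis
    using odd_card_upath_edges_cut[of p "{e}" S] assms by simp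
qed

section \<open>Fundamental cuts of a tree\<close>

lemma rtranclp_imp_distinct_path:
  assumes "R\<^sup>*\<^sup>* a b"
  shows "\<exists>p. p \<noteq> [] \<and> distinct p \<and> hd p = a \<and> last p = b \<and> successively R p"
  using assms
proof (induction rule: rtranclp_induct)
  case base
  show ?case by (intro exI[of _ "[a]"]) auto
next
  case (step y z)
  then obtain p where p: "p \<noteq> []" "distinct p" "hd p = a" "last p = y" "successively R p"
    by blast
  show ?case
  proof (cases "z \<in> set p")
    case True
    then obtain q q' where q: "p = (q @ [z]) @ q'"
      using split_list[of z p] by auto
    then have "successively R (q @ [z])"
      using p(5) by (simp only: successively_append_iff)
    with p q show ?thesis
      by (intro exI[of _ "q @ [z]"]) (cases q; auto)
  next
    case False
    with p step show ?thesis
      by (intro exI[of _ "p @ [z]"]) (auto simp: successively_append_iff)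
  qed
qed

text \<open>Deleting \<open>e\<close> separates its ends, and \<open>S\<close> is the component of
  one of them: a path avoiding \<open>e\<close> between the ends would close up with
  \<open>e\<close> to a cycle. The hypothesis \<open>edges\<close> states well-formedness, which the
  record type does not enforce.\<close>

lemma utree_edge_cut:
  assumes "is_utree T" and "e \<in> uedges T"
    and edges: "\<And>e. e \<in> uedges T \<Longrightarrow> \<exists>a b. e = {a, b} \<and> a \<noteq> b \<and> a \<in> uverts T \<and> b \<in> uverts T"
  shows "\<exists>S. \<forall>x y. {x, y} \<in> uedges T \<longrightarrow> ({x, y} = e \<longleftrightarrow> (x \<in> S) \<noteq> (y \<in> S))"
proof -
  obtain a b where ab: "e = {a, b}" "a \<noteq> b" "a \<in> uverts T"
    using edges assms(2) by blast
  define R where "R = (\<lambda>x y. {x, y} \<in> uedges T - {e})"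
  define S where "S = {v. R\<^sup>*\<^sup>* a v}"
  have sym: "R x y \<longleftrightarrow> R y x" for x y
    by (simp add: R_def insert_commute)
  have S: "x \<in> S \<longleftrightarrow> y \<in> S" if "R x y" for x y
    using that sym unfolding S_def by (metis mem_Collect_eq rtranclp.rtrancl_into_rtrancl)
  have "b \<notin> S"
  proof
    assume "b \<in> S"
    then obtain p where p: "p \<noteq> []" "distinct p" "hd p = a" "last p = b" "successively R p"
      using rtranclp_imp_distinct_path[of R a b] by (auto simp: S_def)
    have succ: "successively (\<lambda>u v. {u, v} \<in> uedges T) p"
      using p(5) by (rule successively_mono) (auto simp: R_def)
    have "set p \<subseteq> uverts T"
    proof
      fix w assume "w \<in> set p"
      moreover have "hd p \<in> uverts T"
        using p ab by simp
      ultimately show "w \<in> uverts T"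
        using succ p(1)
      proof (induction p rule: induct_list012)
        case (3 x y p)
        then obtain c d where "{x, y} = {c, d}" "c \<in> uverts T" "d \<in> uverts T"
          using edges[of "{x, y}"] by auto
        then have "y \<in> uverts T"
          by (auto simp: doubleton_eq_iff)
        with 3 show ?case by auto
      qed auto
    qed
    \<comment> \<open>One vertex would force \<open>a = b\<close>; two vertices would make
      \<open>p\<close> traverse \<open>e\<close> itself, which \<open>R\<close> excludes.\<close>
    moreover have "3 \<le> length p"
    proof (rule ccontr)
      assume "\<not> 3 \<le> length p"
      with p(1) consider x where "p = [x]" | x y where "p = [x, y]"
        by (cases p rule: remdups_adj.cases) (auto simp: Suc_le_eq)
      then show False
        using p(3-5) ab(1,2) by cases (simp_all add: R_def)
    qed
    moreover have "{last p, hd p} \<in> uedges T"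
      using p ab assms(2) by (simp add: insert_commute)
    ultimately have "is_ucycle T p"
      using p(1,2) succ by (simp add: is_ucycle_def is_upath_def)
    with assms(1) show False
      by (auto simp: is_utree_def)
  qed
  have "a \<in> S"
    by (simp add: S_def)
  have "{x, y} = e \<longleftrightarrow> (x \<in> S) \<noteq> (y \<in> S)" if "{x, y} \<in> uedges T" for x y
  proof (cases "{x, y} = e")
    case True
    then have "x = a \<and> y = b \<or> x = b \<and> y = a"
      by (simp add: ab(1) doubleton_eq_iff)
    with True \<open>a \<in> S\<close> \<open>b \<notin> S\<close> show ?thesis by auto
  next
    case False
    with that S[of x y] show ?thesis by (simp add: R_def)
  qed
  then show ?thesis by blast
qed

text \<open>With one cut \<open>D e\<close> per tree edge, the edge set of a path depends on its
  ends alone. This yields uniqueness of tree paths and a description suited to counting modulo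
  2.\<close>

lemma utree_edge_cuts:
  assumes "is_utree T"
    and "\<And>e. e \<in> uedges T \<Longrightarrow> \<exists>a b. e = {a, b} \<and> a \<noteq> b \<and> a \<in> uverts T \<and> b \<in> uverts T"
  obtains D where
    "\<And>p. is_upath T p \<Longrightarrow> upath_edges p = {e \<in> uedges T. (hd p \<in> D e) \<noteq> (last p \<in> D e)}"
proof -
  have "\<forall>e\<in>uedges T. \<exists>S. \<forall>x y. {x, y} \<in> uedges T \<longrightarrow> ({x, y} = e \<longleftrightarrow> (x \<in> S) \<noteq> (y \<in> S))"
    using utree_edge_cut[OF assms(1) _ assms(2)] by blast
  then obtain D where D: "\<And>e x y. e \<in> uedges T \<Longrightarrow> {x, y} \<in> uedges T \<Longrightarrow>
      ({x, y} = e \<longleftrightarrow> (x \<in> D e) \<noteq> (y \<in> D e))"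
    by metis
  have "upath_edges p = {e \<in> uedges T. (hd p \<in> D e) \<noteq> (last p \<in> D e)}" if p: "is_upath T p" for p
  proof -
    have succ: "successively (\<lambda>u v. {u, v} \<in> uedges T) p" and "distinct p" "p \<noteq> []"
      using p by (auto simp: is_upath_def)
    have "e \<in> upath_edges p \<longleftrightarrow> (hd p \<in> D e) \<noteq> (last p \<in> D e)" if "e \<in> uedges T" for e
      using \<open>distinct p\<close> \<open>p \<noteq> []\<close>
      by (rule mem_upath_edges_iff_cut) (rule successively_mono[OF succ], rule D[OF that])
    then show ?thesis
      using upath_edges_subset[OF succ] by blast
  qed
  then show thesis by (rule that)
qed

text \<open>Justifies the definite description: the cut criterion is symmetric in the two ends, so
  both directions of traversal give the same edge set.\<close>

lemma tree_path_edges_eq: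
  assumes "is_utree T"
    and "\<And>e. e \<in> uedges T \<Longrightarrow> \<exists>a b. e = {a, b} \<and> a \<noteq> b \<and> a \<in> uverts T \<and> b \<in> uverts T"
    and "is_upath T p"
  shows "tree_path_edges T {hd p, last p} = upath_edges p"
proof -
  obtain D where D:
    "\<And>p. is_upath T p \<Longrightarrow> upath_edges p = {e \<in> uedges T. (hd p \<in> D e) \<noteq> (last p \<in> D e)}"
    using utree_edge_cuts[OF assms(1,2)] by blast
  show ?thesis
    unfolding tree_path_edges_def
  proof (rule the_equality)
    fix P assume "\<exists>q. is_upath T q \<and> {hd q, last q} = {hd p, last p} \<and> P = upath_edges q"
    then show "P = upath_edges p"
      using D assms(3) by (auto simp: doubleton_eq_iff)
  qed (use assms(3) in blast)
qed

text \<open>Cardinality modulo 2 is additive under symmetric difference.\<close>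

lemma odd_card_neq:
  assumes "finite A"
  shows "odd (card {x \<in> A. P x \<noteq> Q x}) \<longleftrightarrow> odd (card {x \<in> A. P x}) \<noteq> odd (card {x \<in> A. Q x})"
  using assms
proof (induction A rule: finite_induct)
  case (insert a A)
  have "card {x \<in> insert a A. R x} = (if R a then 1 else 0) + card {x \<in> A. R x}" for R
  proof -
    have "{x \<in> insert a A. R x} = (if R a then insert a {x \<in> A. R x} else {x \<in> A. R x})"
      by auto
    then show ?thesis using insert.hyps by simp
  qed
  then show ?case using insert.IH by auto
qed simp

text \<open>A closed walk in a tree uses every edge an even number of times, so counting edges of
  \<open>F\<close> modulo 2 along tree paths integrates to a potential.\<close>

lemma utree_potential:
  assumes "is_utree T" "finite (uedges T)"
    and "\<And>e. e \<in> uedges T \<Longrightarrow> \<exists>a b. e = {a, b} \<and> a \<noteq> b \<and> a \<in> uverts T \<and> b \<in> uverts T"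
  shows "\<exists>\<phi> :: 'a \<Rightarrow> bool. \<forall>p. is_upath T p \<longrightarrow> (\<phi> (hd p) \<noteq> \<phi> (last p) \<longleftrightarrow> odd (card (upath_edges p \<inter> F)))"
proof -
  obtain D where D:
    "\<And>p. is_upath T p \<Longrightarrow> upath_edges p = {e \<in> uedges T. (hd p \<in> D e) \<noteq> (last p \<in> D e)}"
    using utree_edge_cuts[OF assms(1,3)] by blast
  \<comment> \<open>Among the tree edges in \<open>F\<close>, those on the path between two vertices
    form the symmetric difference of the two sets counted here.\<close>
  define \<phi> where "\<phi> v = odd (card {e \<in> uedges T \<inter> F. v \<in> D e})" for v
  have "\<phi> (hd p) \<noteq> \<phi> (last p) \<longleftrightarrow> odd (card (upath_edges p \<inter> F))" if "is_upath T p" for p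
  proof -
    have "upath_edges p \<inter> F = {e \<in> uedges T \<inter> F. (hd p \<in> D e) \<noteq> (last p \<in> D e)}"
      using D[OF that] by auto
    then show ?thesis
      unfolding \<phi>_def using odd_card_neq[of "uedges T \<inter> F"] assms(2) by simp
  qed
  then show ?thesis by blast
qed

section \<open>The grid\<close>

definition grid_adj :: "nat \<times> nat \<Rightarrow> nat \<times> nat \<Rightarrow> bool" where
  "grid_adj u v \<longleftrightarrow>
     fst u = fst v \<and> (snd v = Suc (snd u) \<or> snd u = Suc (snd v)) \<or>
     snd u = snd v \<and> (fst v = Suc (fst u) \<or> fst u = Suc (fst v))"

lemma uverts_grid: "uverts (grid n) = {..<n} \<times> {..<n}"
  by (simp add: grid_def cart_prod_def path_graph_def)

lemma uedges_grid:
  "uedges (grid n) = (\<lambda>(x, y). {(x, y), (x, Suc y)}) ` ({..<n} \<times> {..<n - 1}) \<union>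
     (\<lambda>(x, y). {(x, y), (Suc x, y)}) ` ({..<n - 1} \<times> {..<n})"
  by (fastforce simp: grid_def cart_prod_def path_graph_def doubleton_eq_iff image_iff
        insert_commute)

lemma mem_uedges_grid:
  "{u, v} \<in> uedges (grid n) \<longleftrightarrow> u \<in> uverts (grid n) \<and> v \<in> uverts (grid n) \<and> grid_adj u v"
  by (cases u; cases v)
    (fastforce simp: uedges_grid uverts_grid grid_adj_def doubleton_eq_iff image_iff)

lemma finite_uedges_grid: "finite (uedges (grid n))"
  by (simp add: uedges_grid)

lemma card_uedges_grid_le: "card (uedges (grid n)) \<le> 2 * n\<^sup>2"
proof -
  have "card (uedges (grid n)) \<le> card ({..<n} \<times> {..<n - 1}) + card ({..<n - 1} \<times> {..<n})"
    unfolding uedges_grid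
    by (intro order_trans[OF card_Un_le] add_mono card_image_le) auto
  also have "\<dots> \<le> n * n + n * n"
    by (simp add: card_cartesian_product add_mono)
  finally show ?thesis by (simp add: power2_eq_square)
qed

lemma uedges_gridE:
  assumes "e \<in> uedges (grid n)"
  obtains u v where "e = {u, v}" "u \<noteq> v" "grid_adj u v"
    "u \<in> uverts (grid n)" "v \<in> uverts (grid n)"
proof -
  obtain u v where e: "e = {u, v}"
    using assms by (auto simp: uedges_grid)
  with assms have "grid_adj u v" "u \<in> uverts (grid n)" "v \<in> uverts (grid n)"
    by (simp_all add: mem_uedges_grid)
  moreover from this(1) have "u \<noteq> v"
    by (auto simp: grid_adj_def)
  ultimately show thesis
    using that e by blast
qed

text \<open>Each step moves one coordinate by one. The bounds are written as sums to avoid truncated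
  subtraction.\<close>

lemma grid_path_coordinates:
  assumes "successively grid_adj p" "w \<in> set p"
  shows "fst w < fst (hd p) + length p \<and> fst (hd p) < fst w + length p \<and>
    snd w < snd (hd p) + length p \<and> snd (hd p) < snd w + length p"
  using assms
proof (induction p rule: induct_list012)
  case (3 x y p)
  show ?case
  proof (cases "w = x")
    case False
    with 3 have "fst w < fst y + length (y # p) \<and> fst y < fst w + length (y # p) \<and>
        snd w < snd y + length (y # p) \<and> snd y < snd w + length (y # p)"
      and "grid_adj x y"
      by simp_all
    then show ?thesis
      unfolding grid_adj_def by simp linarith
  qed simp
qed auto

text \<open>The spheres of this distance are the boundaries of axis-parallel squares. Integer values
  avoid truncated subtraction.\<close>

definition cheb_dist :: "nat \<times> nat \<Rightarrow> nat \<times> nat \<Rightarrow> int" where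
  "cheb_dist u v =
     max \<bar>int (fst u) - int (fst v)\<bar> \<bar>int (snd u) - int (snd v)\<bar>"

lemma eq_if_eq_Suc:
  assumes "\<And>i. a \<le> i \<Longrightarrow> i < b \<Longrightarrow> f i = f (Suc i)" "a \<le> b"
  shows "f a = f b"
  using assms(2,1) by (induction b rule: dec_induct) auto

text \<open>\<open>F\<close> is the set of edges crossing the vertical ray that starts in the face to the upper
  right of the centre. The square of radius \<open>r\<close> crosses this ray once, while a cycle
  through an edge of the square that is too short to surround the centre
  crosses it an even number of times.\<close>

lemma square_has_long_fundamental_cycle:
  assumes T: "is_spanning_tree T (grid n)"
    and r: "0 < r" "r \<le> a" "r \<le> b" "a + r < n" "b + r < n"
  shows "\<exists>e \<in> uedges (grid n) - uedges T.
    (\<forall>w\<in>e. cheb_dist w (a, b) = int r) \<and> r \<le> card (fundamental_cycle T e)"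
proof (rule ccontr)
  assume "\<not> ?thesis"
  then have short: "card (fundamental_cycle T e) < r"
    if "e \<in> uedges (grid n)" "e \<notin> uedges T" "\<forall>w\<in>e. cheb_dist w (a, b) = int r" for e
    using that by (auto simp: not_le)
  have tree: "is_utree T" and verts: "uverts T = uverts (grid n)"
    and sub: "uedges T \<subseteq> uedges (grid n)"
    using T by (auto simp: is_spanning_tree_def)
  have fin: "finite (uedges T)"
    using sub finite_uedges_grid finite_subset by blast
  have edges: "\<exists>u v. e = {u, v} \<and> u \<noteq> v \<and> u \<in> uverts T \<and> v \<in> uverts T"
    if "e \<in> uedges T" for e
    using that sub verts by (metis subsetD uedges_gridE)
  define F where "F = {{(a, y), (Suc a, y)} |y. b < y}"
  have F_iff: "{u, v} \<in> F \<longleftrightarrow> b < snd u \<and> b < snd v \<and> (fst u \<le> a) \<noteq> (fst v \<le> a)"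
    if "grid_adj u v" for u v
    using that unfolding F_def grid_adj_def
    by (cases u; cases v) (auto simp: doubleton_eq_iff)
  obtain \<phi> :: "nat \<times> nat \<Rightarrow> bool" where \<phi>:
    "\<And>p. is_upath T p \<Longrightarrow> \<phi> (hd p) \<noteq> \<phi> (last p) \<longleftrightarrow> odd (card (upath_edges p \<inter> F))"
    using utree_potential[OF tree fin edges, of F] by blast
  \<comment> \<open>Along every edge of the square, whether in the tree or not,
    \<open>\<phi>\<close> changes exactly when the edge crosses the ray. The tree path replacing a
    non-tree edge is too short to go round the centre.\<close>
  have key: "\<phi> u \<noteq> \<phi> v \<longleftrightarrow> {u, v} \<in> F"
    if uv: "{u, v} \<in> uedges (grid n)" and sq: "cheb_dist u (a, b) = int r" "cheb_dist v (a, b) = int r"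
    for u v
  proof -
    have adj: "grid_adj u v" and V: "u \<in> uverts T" "v \<in> uverts T"
      using uv verts by (auto simp: mem_uedges_grid)
    then have "u \<noteq> v" by (auto simp: grid_adj_def)
    show ?thesis
    proof (cases "{u, v} \<in> uedges T")
      case True
      then have "is_upath T [u, v]"
        using V \<open>u \<noteq> v\<close> by (simp add: is_upath_def)
      from \<phi>[OF this] show ?thesis
        by (cases "{u, v} \<in> F") auto
    next
      case False
      obtain p where p: "is_upath T p" "hd p = u" "last p = v"
        using tree V unfolding is_utree_def uconnected_def by blast
      then have P: "p \<noteq> []" "distinct p" "successively (\<lambda>u v. {u, v} \<in> uedges T) p"
        by (auto simp: is_upath_def)
      have succ: "successively grid_adj p"
        using P(3) by (rule successively_mono) (use sub mem_uedges_grid in blast)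
      have "upath_edges p \<subseteq> fundamental_cycle T {u, v}"
        using tree_path_edges_eq[OF tree edges p(1)] p by (auto simp: fundamental_cycle_def)
      moreover have "finite (fundamental_cycle T {u, v})"
        using tree_path_edges_eq[OF tree edges p(1)] p by (auto simp: fundamental_cycle_def)
      ultimately have "card (upath_edges p) \<le> card (fundamental_cycle T {u, v})"
        by (rule card_mono[rotated])
      also have "\<dots> < r"
        using short[OF uv False] sq by simp
      finally have "card (upath_edges p) < r" .
      then have len: "length p \<le> r"
        using card_upath_edges[OF P(2)] by simp
      note near = grid_path_coordinates[OF succ, unfolded p(2)]
      have "u \<in> set p" "v \<in> set p"
        using p P(1) by auto
      \<comment> \<open>The vertex \<open>u\<close> is at offset exactly \<open>r\<close> from a
        central line, and \<open>p\<close> has at most \<open>r\<close> vertices, so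
        \<open>p\<close> stays on one side of that line.\<close>
      have cases: "(\<forall>w\<in>set p. b < snd w) \<or> (\<forall>w\<in>set p. snd w \<le> b) \<or>
          (\<forall>w\<in>set p. a < fst w) \<or> (\<forall>w\<in>set p. fst w \<le> a)"
      proof -
        consider "snd u = b + r" | "snd u + r = b" | "fst u = a + r" | "fst u + r = a"
          using sq(1) unfolding cheb_dist_def by fastforce
        then show ?thesis
        proof cases
          case 1
          then have "\<forall>w\<in>set p. b < snd w" using near len by fastforce
          then show ?thesis by blast
        next
          case 2
          then have "\<forall>w\<in>set p. snd w \<le> b" using near len by fastforce
          then show ?thesis by blast
        next
          case 3
          then have "\<forall>w\<in>set p. a < fst w" using near len by fastforce
          then show ?thesis by blast
        next
          case 4
          then have "\<forall>w\<in>set p. fst w \<le> a" using near len by fastforce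
          then show ?thesis by blast
        qed
      qed
      \<comment> \<open>Above height \<open>b\<close>, the edges in \<open>F\<close> are exactly
        those crossing from column \<open>a\<close> to the next one, so a half-plane serves as the
        cut. In the other cases no two vertices of \<open>p\<close> span an edge in
        \<open>F\<close>, and the empty set works.\<close>
      define S where "S = (if \<forall>w\<in>set p. b < snd w then {w. fst w \<le> a} else ({} :: (nat \<times> nat) set))"
      have F_S: "{x, y} \<in> F \<longleftrightarrow> (x \<in> S) \<noteq> (y \<in> S)"
        if "grid_adj x y" "x \<in> set p" "y \<in> set p" for x y
        using cases that(2,3) unfolding F_iff[OF that(1)] S_def by (auto simp: not_le not_less)
      have "successively (\<lambda>x y. {x, y} \<in> F \<longleftrightarrow> (x \<in> S) \<noteq> (y \<in> S)) p"
        using succ by (rule successively_mono) (use F_S in blast)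
      then have "odd (card (upath_edges p \<inter> F)) \<longleftrightarrow> (u \<in> S) \<noteq> (v \<in> S)"
        using odd_card_upath_edges_cut[OF P(2,1)] p by simp
      then show ?thesis
        using \<phi>[OF p(1)] p F_S[OF adj \<open>u \<in> set p\<close> \<open>v \<in> set p\<close>] by simp
    qed
  qed
  have hor: "\<phi> (x, y) \<noteq> \<phi> (Suc x, y) \<longleftrightarrow> x = a \<and> b < y"
    if "a - r \<le> x" "x < a + r" "y = b + r \<or> y = b - r" for x y
  proof -
    have "{(x, y), (Suc x, y)} \<in> uedges (grid n)"
      using that r by (auto simp: mem_uedges_grid uverts_grid grid_adj_def)
    moreover have "cheb_dist (x, y) (a, b) = int r" "cheb_dist (Suc x, y) (a, b) = int r"
      using that r by (auto simp: cheb_dist_def)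
    ultimately show ?thesis
      using key[of "(x, y)" "(Suc x, y)"] F_iff[of "(x, y)" "(Suc x, y)"]
      by (auto simp: grid_adj_def)
  qed
  have ver: "\<phi> (x, y) = \<phi> (x, Suc y)"
    if "b - r \<le> y" "y < b + r" "x = a + r \<or> x = a - r" for x y
  proof -
    have "{(x, y), (x, Suc y)} \<in> uedges (grid n)"
      using that r by (auto simp: mem_uedges_grid uverts_grid grid_adj_def)
    moreover have "cheb_dist (x, y) (a, b) = int r" "cheb_dist (x, Suc y) (a, b) = int r"
      using that r by (auto simp: cheb_dist_def)
    ultimately show ?thesis
      using key[of "(x, y)" "(x, Suc y)"] F_iff[of "(x, y)" "(x, Suc y)"]
      by (auto simp: grid_adj_def)
  qed
  have hor_eq: "\<phi> (x, y) = \<phi> (Suc x, y)"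
    if "a - r \<le> x" "x < a + r" "y = b + r \<or> y = b - r" "x \<noteq> a \<or> y \<le> b" for x y
    using hor[OF that(1-3)] that(4) by auto
  \<comment> \<open>Go clockwise round the square from just right of the ray back to just left of
    it: \<open>\<phi>\<close> stays constant, yet it must change on the one remaining edge, the only
    one in \<open>F\<close>.\<close>
  have "\<phi> (Suc a, b + r) = \<phi> (a + r, b + r)"
    by (rule eq_if_eq_Suc[where f = "\<lambda>x. \<phi> (x, b + r)"]; (rule hor_eq)?) (use r in auto)
  also have "\<dots> = \<phi> (a + r, b - r)"
    by (rule eq_if_eq_Suc[where f = "\<lambda>y. \<phi> (a + r, y)", symmetric]; (rule ver)?) (use r in auto)
  also have "\<dots> = \<phi> (a - r, b - r)"
    by (rule eq_if_eq_Suc[where f = "\<lambda>x. \<phi> (x, b - r)", symmetric]; (rule hor_eq)?) (use r in auto)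
  also have "\<dots> = \<phi> (a - r, b + r)"
    by (rule eq_if_eq_Suc[where f = "\<lambda>y. \<phi> (a - r, y)"]; (rule ver)?) (use r in auto)
  also have "\<dots> = \<phi> (a, b + r)"
    by (rule eq_if_eq_Suc[where f = "\<lambda>x. \<phi> (x, b + r)"]; (rule hor_eq)?) (use r in auto)
  finally show False
    using hor[of a "b + r"] r by auto
qed

section \<open>Summation over scales\<close>

text \<open>A square of radius at most \<open>h\<close> about the point at offset \<open>h\<close>
  stays inside its box of side \<open>s\<close>, so division by \<open>s\<close> recovers the box
  from any vertex of the square.\<close>

lemma cheb_dist_box_unique:
  assumes "cheb_dist w (i * s + h, j * s + h) = int r" "2 * h < s" "r \<le> h"
  shows "i = fst w div s" "j = snd w div s"
proof -
  have "\<bar>int (fst w) - int (i * s + h)\<bar> \<le> int r" "\<bar>int (snd w) - int (j * s + h)\<bar> \<le> int r"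
    using assms(1) by (simp_all add: cheb_dist_def flip: assms(1))
  then have "i * s \<le> fst w" "fst w < i * s + s" "j * s \<le> snd w" "snd w < j * s + s"
    using assms(2,3) by linarith+
  then show "i = fst w div s" "j = snd w div s"
    by (auto intro!: div_nat_eqI[symmetric] simp: mult.commute)
qed

text \<open>Choose one long edge for each box and each radius. Any end of the edge determines its
  box by division, then its radius as distance to the centre, so distinct choices give distinct
  edges.\<close>

lemma many_long_fundamental_cycles:
  assumes T: "is_spanning_tree T (grid n)" and "0 < t"
  shows "(n div (5 * t))\<^sup>2 * t \<le>
    card {e \<in> uedges (grid n) - uedges T. t \<le> card (fundamental_cycle T e)}"
    (is "_ \<le> card ?N")
proof -
  define q where "q = n div (5 * t)"
  \<comment> \<open>At offset \<open>2 * t\<close>, squares of radius below \<open>2 * t\<close> fit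
    into a box of side \<open>5 * t\<close>.\<close>
  define c where "c = (\<lambda>i j. (i * (5 * t) + 2 * t, j * (5 * t) + 2 * t))"
  define I where "I = ({..<q} \<times> {..<q}) \<times> {t..<2 * t}"
  have "\<exists>e\<in>?N. \<forall>w\<in>e. cheb_dist w (c i j) = int r"
    if "i < q" "j < q" "t \<le> r" "r < 2 * t" for i j r
  proof -
    have "Suc k * (5 * t) \<le> n" if "k < q" for k
      using that unfolding q_def
      by (metis Suc_leI div_times_less_eq_dividend dual_order.trans mult_le_mono1)
    then have "i * (5 * t) + 5 * t \<le> n" "j * (5 * t) + 5 * t \<le> n"
      using that by fastforce+
    then show ?thesis
      using square_has_long_fundamental_cycle[OF T, of r "i * (5 * t) + 2 * t" "j * (5 * t) + 2 * t"]
        that \<open>0 < t\<close> unfolding c_def by (force intro: order_trans)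
  qed
  then have "\<forall>k\<in>I. \<exists>e\<in>?N. \<forall>w\<in>e. cheb_dist w (c (fst (fst k)) (snd (fst k))) = int (snd k)"
    by (auto simp: I_def)
  then have "\<exists>g. \<forall>k\<in>I. g k \<in> ?N \<and>
      (\<forall>w\<in>g k. cheb_dist w (c (fst (fst k)) (snd (fst k))) = int (snd k))"
    unfolding Bex_def by (rule bchoice)
  then obtain g where g: "\<And>k. k \<in> I \<Longrightarrow> g k \<in> ?N"
    "\<And>k w. k \<in> I \<Longrightarrow> w \<in> g k \<Longrightarrow> cheb_dist w (c (fst (fst k)) (snd (fst k))) = int (snd k)"
    by blast
  have "inj_on g I"
  proof (rule inj_onI)
    fix k l assume kl: "k \<in> I" "l \<in> I" "g k = g l"
    have "g k \<in> uedges (grid n)"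
      using g(1)[OF kl(1)] by simp
    then obtain w where w: "w \<in> g k"
      by (rule uedges_gridE) auto
    have *: "fst (fst m) = fst w div (5 * t) \<and> snd (fst m) = snd w div (5 * t)"
      if "m \<in> I" "w \<in> g m" for m
      using cheb_dist_box_unique[OF g(2)[OF that, unfolded c_def]] that(1) \<open>0 < t\<close>
      by (auto simp: I_def)
    have "fst k = fst l"
      using * kl w by (metis prod.expand)
    moreover have "snd k = snd l"
      using g(2)[OF kl(1) w] g(2)[OF kl(2)] w kl(3) \<open>fst k = fst l\<close> by simp
    ultimately show "k = l" by (rule prod_eqI)
  qed
  moreover have "g ` I \<subseteq> ?N"
    using g(1) by blast
  moreover have "finite ?N"
    using finite_uedges_grid by simp
  ultimately have "card I \<le> card ?N"
    by (rule card_inj_on_le)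
  then show ?thesis
    by (simp add: I_def q_def card_cartesian_product power2_eq_square)
qed

text \<open>A geometric sum with ratio 5 is less than 5/4 of its largest term, hence the weight 4/5.
  It ensures that no cycle is charged more than its length over all scales.\<close>

lemma sum_powers_le:
  "(\<Sum>k<L. if 5 ^ k \<le> m then 4 / 5 * 5 ^ k else 0) \<le> real m"
proof -
  \<comment> \<open>The second bound drives the induction: \<open>5 ^ L / 5\<close> plus the new
    term is \<open>5 ^ L\<close>, which is at most \<open>m\<close> when that term is
    present.\<close>
  have "(\<Sum>k<L. if 5 ^ k \<le> m then 4 / 5 * 5 ^ k else 0) \<le> min (real m) (5 ^ L / 5)"
  proof (induction L)
    case (Suc L)
    show ?case
    proof (cases "5 ^ L \<le> m")
      case True
      then have "(5 :: real) ^ L \<le> real m"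
        by (metis of_nat_le_iff of_nat_numeral of_nat_power)
      with Suc True show ?thesis by (auto simp: min_def split: if_splits)
    next
      case False
      with Suc show ?thesis by (auto intro: order_trans)
    qed
  qed simp
  then show ?thesis by simp
qed

lemma sum_fundamental_cycles_ge:
  assumes T: "is_spanning_tree T (grid n)" and "5 ^ L \<le> n"
  shows "real L * (real n)\<^sup>2 / 125 \<le>
    (\<Sum>e\<in>uedges (grid n) - uedges T. real (card (fundamental_cycle T e)))"
proof -
  define M where "M = uedges (grid n) - uedges T"
  define f where "f e = card (fundamental_cycle T e)" for e
  have "finite M"
    using finite_uedges_grid by (simp add: M_def)
  have scale: "(real n)\<^sup>2 / 125 \<le> (\<Sum>e\<in>M. if 5 ^ k \<le> f e then 4 / 5 * 5 ^ k else 0)"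
    if "k < L" for k
  proof -
    define t :: nat where "t = 5 ^ k"
    define q where "q = n div (5 * t)"
    have "0 < t" by (simp add: t_def)
    \<comment> \<open>Since \<open>k < L\<close>, at least one box fits; \<open>q \<ge> 1\<close>
      then permits replacing \<open>Suc q\<close> by \<open>2 * q\<close> below.\<close>
    have "5 * t \<le> 5 ^ L"
      using that power_increasing[of "Suc k" L "5::nat"] by (simp add: t_def)
    then have "5 * t \<le> n" using assms(2) by simp
    then have "0 < q"
      using \<open>0 < t\<close> by (simp add: q_def div_greater_zero_iff)
    have "n < Suc q * (5 * t)"
      unfolding q_def using \<open>0 < t\<close> by (simp add: dividend_less_div_times add.commute)
    also have "\<dots> \<le> (2 * q) * (5 * t)"
      using \<open>0 < q\<close> by (intro mult_right_mono) auto
    finally have "n \<le> 10 * (q * t)" by simp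
    then have "real n \<le> 10 * (real q * real t)"
      by (metis of_nat_le_iff of_nat_mult of_nat_numeral)
    then have "(real n)\<^sup>2 \<le> (10 * (real q * real t))\<^sup>2"
      by (intro power_mono) auto
    \<comment> \<open>The constant is 4/5 divided by \<open>10\<^sup>2\<close>.\<close>
    then have "(real n)\<^sup>2 / 125 \<le> 4 / 5 * real t * real (q\<^sup>2 * t)"
      by (simp add: power2_eq_square field_simps)
    also have "\<dots> \<le> 4 / 5 * real t * real (card {e \<in> M. t \<le> f e})"
      using many_long_fundamental_cycles[OF T \<open>0 < t\<close>]
      unfolding M_def f_def q_def by (intro mult_left_mono) (auto simp del: of_nat_mult)
    also have "\<dots> = (\<Sum>e\<in>M. if t \<le> f e then 4 / 5 * real t else 0)"
      using \<open>finite M\<close> by (simp add: sum.If_cases Int_def)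
    finally show ?thesis by (simp add: t_def cong: if_cong)
  qed
  have "real L * (real n)\<^sup>2 / 125 = (\<Sum>k<L. (real n)\<^sup>2 / 125)"
    by simp
  also have "\<dots> \<le> (\<Sum>k<L. \<Sum>e\<in>M. if 5 ^ k \<le> f e then 4 / 5 * 5 ^ k else 0)"
    using scale by (intro sum_mono) auto
  also have "\<dots> = (\<Sum>e\<in>M. \<Sum>k<L. if 5 ^ k \<le> f e then 4 / 5 * 5 ^ k else 0)"
    by (rule sum.swap)
  also have "\<dots> \<le> (\<Sum>e\<in>M. real (f e))"
    by (intro sum_mono sum_powers_le)
  finally show ?thesis by (simp add: M_def f_def)
qed

theorem corollary5:
  fixes n :: nat and T :: "(nat \<times> nat) ugraph"
  assumes "n \<ge> 2"
    and "is_spanning_tree T (grid n)"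
  shows "avg_fundamental_cycle_length (grid n) T \<ge> 2 / 625 * real_of_int \<lfloor>log 5 (real n)\<rfloor>"
proof -
  define L where "L = nat \<lfloor>log 5 (real n)\<rfloor>"
  define M where "M = uedges (grid n) - uedges T"
  define s where "s = (\<Sum>e\<in>M. real (card (fundamental_cycle T e)))"
  have "0 \<le> log 5 (real n)"
    using assms(1) by simp
  then have L: "real L = real_of_int \<lfloor>log 5 (real n)\<rfloor>"
    by (simp add: L_def)
  have "5 powr real L \<le> real n"
    using assms(1) L by (subst le_log_iff[symmetric]) auto
  then have "5 ^ L \<le> n"
    by (metis of_nat_le_iff of_nat_numeral of_nat_power powr_realpow zero_less_numeral)
  then have s: "real L * (real n)\<^sup>2 / 125 \<le> s"
    unfolding s_def M_def using sum_fundamental_cycles_ge assms(2) by blast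
  have "card M \<le> 2 * n\<^sup>2"
    unfolding M_def
    by (rule order_trans[OF card_mono card_uedges_grid_le]) (auto simp: finite_uedges_grid)
  then have "real (card M) \<le> 2 * (real n)\<^sup>2"
    using of_nat_mono[of "card M" "2 * n\<^sup>2", where 'a = real] by simp
  \<comment> \<open>Twice 2/625 is 4/625, which is below 1/125.\<close>
  then have "2 / 625 * real L * real (card M) \<le> 2 / 625 * real L * (2 * (real n)\<^sup>2)"
    by (intro mult_left_mono) auto
  also have "\<dots> \<le> real L * (real n)\<^sup>2 / 125"
    by simp
  finally have le: "2 / 625 * real L * real (card M) \<le> s"
    using s by simp
  have "2 / 625 * real L \<le> s / real (card M)"
  proof (cases "card M = 0")
    \<comment> \<open>Division by zero makes the average 0 here; the empty sum then forces
      \<open>L = 0\<close>.\<close>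
    case True
    moreover have "finite M"
      by (simp add: M_def finite_uedges_grid)
    ultimately have "M = {}" by simp
    then have "s = 0" by (simp add: s_def)
    then have "L = 0"
      using s assms(1) by (simp add: mult_le_0_iff)
    then show ?thesis using True by simp
  next
    case False
    with le show ?thesis by (simp add: pos_le_divide_eq)
  qed
  then show ?thesis
    by (simp add: avg_fundamental_cycle_length_def s_def M_def L)
qed

end
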